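(* Let $\Gamma$ be a Coxeter graph with finite vertex set $S$, and let $(W,S)$ be the Coxeter system of type $\Gamma$. Then, for every linear ordering $S=\{s_1,s_2,\dots,s_n\}$ of $S$, the Coxeter element $c=s_n\cdots s_2s_1$ of $W$ is essential.
   Context: A Coxeter matrix over a finite set $S$ is a matrix $(m_{s\,t})_{s,t\in S}$ with $m_{s\,s}=1$ and $m_{s\,t}=m_{t\,s}\in\{2,3,\dots,+\infty\}$ for $s\neq t$. Its Coxeter graph $\Gamma$ has vertex set $S$, with an edge between $s$ and $t$ if $m_{s\,t}\ge 3$, labeled by $m_{s\,t}$ if $m_{s\,t}\ge 4$. The Coxeter system of type $\Gamma$ is $(W,S)$, where $W=W_\Gamma$ is the group generated by $S$ with relations $s^2=1$ for $s\in S$ and $(st)^{m_{s\,t}}=1$ for $s\ne t$, $m_{s\,t}<+\infty$. For $X\subset S$, $W_X$ denotes the subgroup of $W$ generated by $X$; such subgroups are called standard parabolic subgroups, and a parabolic subgroup is a subgroup conjugate in $W$ to a standard parabolic subgroup. An element $w\in W$ is essential if it does not lie in any proper parabolic subgroup of $W$. *)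

theory Defs
  imports "HOL-Algebra.Generated_Groups" "HOL-Library.Extended_Nat"
begin

section \<open>Groups given by generators and relators\<close>

text \<open>The letter \<open>(s, True)\<close> stands for the generator \<open>s\<close>, and \<open>(s, False)\<close> for its formal inverse.\<close>

definition group_words :: "'a set \<Rightarrow> ('a \<times> bool) list set" where
  "group_words S = lists (S \<times> UNIV)"

inductive_set pres_rel :: "'a set \<Rightarrow> ('a \<times> bool) list set \<Rightarrow> (('a \<times> bool) list \<times> ('a \<times> bool) list) set"
  for S R where
    refl: "u \<in> group_words S \<Longrightarrow> (u, u) \<in> pres_rel S R"
  | sym: "(u, v) \<in> pres_rel S R \<Longrightarrow> (v, u) \<in> pres_rel S R"
  | trans: "(u, v) \<in> pres_rel S R \<Longrightarrow> (v, w) \<in> pres_rel S R \<Longrightarrow> (u, w) \<in> pres_rel S R"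
  | cancel: "u \<in> group_words S \<Longrightarrow> v \<in> group_words S \<Longrightarrow> s \<in> S \<Longrightarrow>
      (u @ [(s, b), (s, \<not> b)] @ v, u @ v) \<in> pres_rel S R"
  | relator: "u \<in> group_words S \<Longrightarrow> v \<in> group_words S \<Longrightarrow> r \<in> R \<Longrightarrow> r \<in> group_words S \<Longrightarrow>
      (u @ r @ v, u @ v) \<in> pres_rel S R"

definition presented_group :: "'a set \<Rightarrow> ('a \<times> bool) list set \<Rightarrow> ('a \<times> bool) list set monoid" where
  "presented_group S R = \<lparr>carrier = group_words S // pres_rel S R,
     mult = (\<lambda>A B. \<Union>u\<in>A. \<Union>v\<in>B. pres_rel S R `` {u @ v}),
     one = pres_rel S R `` {[]}\<rparr>"

lemma pres_rel_in_words:
  "(u, v) \<in> pres_rel S R \<Longrightarrow> u \<in> group_words S \<and> v \<in> group_words S"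
  by (induction rule: pres_rel.induct) (auto simp: group_words_def)

lemma equiv_pres_rel: "equiv (group_words S) (pres_rel S R)"
proof (rule equivI)
  show "pres_rel S R \<subseteq> group_words S \<times> group_words S"
    using pres_rel_in_words by fastforce
  show "refl_on (group_words S) (pres_rel S R)"
    by (auto simp: refl_on_def intro: pres_rel.refl dest: pres_rel_in_words)
  show "sym (pres_rel S R)" by (auto simp: sym_def intro: pres_rel.sym)
  show "trans (pres_rel S R)" unfolding trans_def by (blast intro: pres_rel.trans)
qed

lemma pres_rel_append_context:
  assumes "(u, v) \<in> pres_rel S R" "x \<in> group_words S" "y \<in> group_words S"
  shows "(x @ u @ y, x @ v @ y) \<in> pres_rel S R"
  using assms
proof (induction rule: pres_rel.induct)
  case (refl u)
  then show ?case by (intro pres_rel.refl) (auto simp: group_words_def)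
next
  case (cancel u v s b)
  then show ?case
    using pres_rel.cancel[of "x @ u" S "v @ y" s b R] by (auto simp: group_words_def)
next
  case (relator u v r)
  then show ?case
    using pres_rel.relator[of "x @ u" S "v @ y" r R] by (auto simp: group_words_def)
qed (blast intro: pres_rel.sym pres_rel.trans)+

lemma pres_rel_append:
  assumes "(u, u') \<in> pres_rel S R" "(v, v') \<in> pres_rel S R"
  shows "(u @ v, u' @ v') \<in> pres_rel S R"
proof (rule pres_rel.trans)
  show "(u @ v, u' @ v) \<in> pres_rel S R"
    using pres_rel_append_context[OF assms(1), of "[]" v] pres_rel_in_words[OF assms(2)]
    by (simp add: group_words_def)
  show "(u' @ v, u' @ v') \<in> pres_rel S R"
    using pres_rel_append_context[OF assms(2), of u' "[]"] pres_rel_in_words[OF assms(1)]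
    by (simp add: group_words_def)
qed

lemma presented_group_mult:
  assumes "u \<in> group_words S" "v \<in> group_words S"
  shows "pres_rel S R `` {u} \<otimes>\<^bsub>presented_group S R\<^esub> pres_rel S R `` {v} = pres_rel S R `` {u @ v}"
proof -
  have "congruent2 (pres_rel S R) (pres_rel S R) (\<lambda>u v. pres_rel S R `` {u @ v})"
    unfolding congruent2_def using pres_rel_append equiv_class_eq[OF equiv_pres_rel] by fast
  then show ?thesis
    using UN_equiv_class2[OF equiv_pres_rel equiv_pres_rel _ assms] by (simp add: presented_group_def)
qed

lemma pres_rel_inverse:
  "u \<in> group_words S \<Longrightarrow> (rev (map (\<lambda>(s, b). (s, \<not> b)) u) @ u, []) \<in> pres_rel S R"
proof (induction u)
  case Nil
  then show ?case by (simp add: group_words_def pres_rel.refl)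
next
  case (Cons a u)
  obtain s b where a: "a = (s, b)" by force
  let ?v = "rev (map (\<lambda>(s, b). (s, \<not> b)) u)"
  have u: "u \<in> group_words S" "s \<in> S" and v: "?v \<in> group_words S"
    using Cons.prems by (auto simp: a group_words_def)
  have "(?v @ [(s, \<not> b), (s, \<not> \<not> b)] @ u, ?v @ u) \<in> pres_rel S R"
    using u v by (intro pres_rel.cancel)
  then show ?case using Cons.IH[OF u(1)] by (auto simp: a intro: pres_rel.trans)
qed

lemma group_presented_group: "group (presented_group S R)"
proof -
  let ?c = "\<lambda>u. pres_rel S R `` {u}"
  have car: "carrier (presented_group S R) = ?c ` group_words S"
    by (auto simp: presented_group_def quotient_def)
  have one: "\<one>\<^bsub>presented_group S R\<^esub> = ?c []" by (simp add: presented_group_def)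
  have app: "u @ v \<in> group_words S" if "u \<in> group_words S" "v \<in> group_words S" for u v
    using that by (simp add: group_words_def)
  have nil: "[] \<in> group_words S" by (simp add: group_words_def)
  show ?thesis
  proof (rule groupI)
    fix x assume "x \<in> carrier (presented_group S R)"
    then obtain u where u: "u \<in> group_words S" "x = ?c u" by (auto simp: car)
    let ?v = "rev (map (\<lambda>(s, b). (s, \<not> b)) u)"
    have v: "?v \<in> group_words S" using u(1) by (auto simp: group_words_def)
    have "?c ?v \<otimes>\<^bsub>presented_group S R\<^esub> x = \<one>\<^bsub>presented_group S R\<^esub>"
      using equiv_class_eq[OF equiv_pres_rel pres_rel_inverse[OF u(1)]]
      by (simp add: u presented_group_mult v one)
    then show "\<exists>y\<in>carrier (presented_group S R). y \<otimes>\<^bsub>presented_group S R\<^esub> x = \<one>\<^bsub>presented_group S R\<^esub>"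
      using v by (auto simp: car)
  qed (auto simp: car one presented_group_mult app nil)
qed


section \<open>Coxeter groups\<close>

text \<open>Coxeter graphs on the vertex set \<open>S\<close> are represented by their Coxeter matrices: vertices
  \<open>s \<noteq> t\<close> are not joined if \<open>m s t = 2\<close>, are joined by an unlabelled edge if \<open>m s t = 3\<close>, and by
  an edge labelled \<open>m s t\<close> (possibly \<open>\<infinity>\<close>) otherwise. Values of \<open>m\<close> outside \<open>S\<close> are irrelevant.\<close>

definition coxeter_matrix :: "'a set \<Rightarrow> ('a \<Rightarrow> 'a \<Rightarrow> enat) \<Rightarrow> bool" where
  "coxeter_matrix S m \<longleftrightarrow>
     (\<forall>s\<in>S. m s s = 1) \<and> (\<forall>s\<in>S. \<forall>t\<in>S. s \<noteq> t \<longrightarrow> m s t = m t s \<and> m s t \<ge> 2)"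

definition coxeter_relators :: "'a set \<Rightarrow> ('a \<Rightarrow> 'a \<Rightarrow> enat) \<Rightarrow> ('a \<times> bool) list set" where
  "coxeter_relators S m =
     {[(s, True), (s, True)] | s. s \<in> S} \<union>
     {concat (replicate k [(s, True), (t, True)]) | s t k. s \<in> S \<and> t \<in> S \<and> s \<noteq> t \<and> m s t = enat k}"

definition coxeter_group :: "'a set \<Rightarrow> ('a \<Rightarrow> 'a \<Rightarrow> enat) \<Rightarrow> ('a \<times> bool) list set monoid" where
  "coxeter_group S m = presented_group S (coxeter_relators S m)"

definition coxeter_gen :: "'a set \<Rightarrow> ('a \<Rightarrow> 'a \<Rightarrow> enat) \<Rightarrow> 'a \<Rightarrow> ('a \<times> bool) list set" where
  "coxeter_gen S m s = pres_rel S (coxeter_relators S m) `` {[(s, True)]}"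

definition standard_parabolic ::
    "'a set \<Rightarrow> ('a \<Rightarrow> 'a \<Rightarrow> enat) \<Rightarrow> 'a set \<Rightarrow> ('a \<times> bool) list set set" where
  "standard_parabolic S m X = generate (coxeter_group S m) (coxeter_gen S m ` X)"

definition parabolic_subgroup ::
    "'a set \<Rightarrow> ('a \<Rightarrow> 'a \<Rightarrow> enat) \<Rightarrow> ('a \<times> bool) list set set \<Rightarrow> bool" where
  "parabolic_subgroup S m H \<longleftrightarrow>
     (\<exists>X g. X \<subseteq> S \<and> g \<in> carrier (coxeter_group S m) \<and>
        H = (\<lambda>x. g \<otimes>\<^bsub>coxeter_group S m\<^esub> x \<otimes>\<^bsub>coxeter_group S m\<^esub> inv\<^bsub>coxeter_group S m\<^esub> g)
              ` standard_parabolic S m X)"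

definition essential :: "'a set \<Rightarrow> ('a \<Rightarrow> 'a \<Rightarrow> enat) \<Rightarrow> ('a \<times> bool) list set \<Rightarrow> bool" where
  "essential S m w \<longleftrightarrow> w \<in> carrier (coxeter_group S m) \<and>
     \<not> (\<exists>H. parabolic_subgroup S m H \<and> H \<noteq> carrier (coxeter_group S m) \<and> w \<in> H)"

text \<open>For \<open>ss = [s\<^sub>1, \<dots>, s\<^sub>n]\<close> this is the product \<open>s\<^sub>n \<cdots> s\<^sub>2 s\<^sub>1\<close>.\<close>

definition coxeter_element ::
    "'a set \<Rightarrow> ('a \<Rightarrow> 'a \<Rightarrow> enat) \<Rightarrow> 'a list \<Rightarrow> ('a \<times> bool) list set" where
  "coxeter_element S m ss =
     foldr (\<lambda>s w. coxeter_gen S m s \<otimes>\<^bsub>coxeter_group S m\<^esub> w) (rev ss) \<one>\<^bsub>coxeter_group S m\<^esub>"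

end

theory Submission
  imports Defs Complex_Main
begin

text \<open>
  Let a proper parabolic subgroup \<open>g W\<^sub>X g\<inverse>\<close> be given, so that some \<open>s\<^sub>0 \<in> S\<close> lies outside \<open>X\<close>.
  The group \<open>W\<close> acts on \<open>\<real>\<^sup>S\<close> by affine maps: with \<open>a s t = - 2 cos (\<pi> / m s t)\<close> the usual Cartan
  numbers and \<open>y \<in> \<real>\<^sup>S\<close> any vector of constants, the generator \<open>s\<close> changes the coordinate \<open>x s\<close> only
  and subtracts from it the affine form \<open>(\<Sum>t. a s t * x t) + y s\<close>. Take for \<open>y\<close> the unit vector at
  \<open>s\<^sub>0\<close>. Then all generators except \<open>s\<^sub>0\<close> fix the origin, hence so does \<open>W\<^sub>X\<close>, but \<open>s\<^sub>0\<close> moves it.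

  A Coxeter element \<open>c\<close> uses every generator exactly once, so each coordinate is touched at most once
  while \<open>c\<close> is applied. Therefore a fixed point of \<open>c\<close> is fixed by each generator
  (\<open>fixed_by_each_reflection\<close>), hence by \<open>W\<close>. If \<open>c\<close> belonged to \<open>g W\<^sub>X g\<inverse>\<close> it would
  fix the image of the origin under \<open>g\<close>; this image would be fixed by \<open>W\<close>, in particular by \<open>g\<inverse>\<close>,
  so it would be the origin itself, which \<open>s\<^sub>0\<close> moves: a contradiction.

  The affine action comes from a linear one. In the contragredient of the geometric
  representation, reflections subtract multiples of vectors that are linearly dependent if the Cartan
  matrix is singular, and then a Coxeter element may have fixed vectors that not all generators
  fix. In \<open>\<real>\<^sup>S \<oplus> \<real>\<^sup>S\<close>, where the reflection \<open>s\<close> subtracts a multiple of the \<open>s\<close>-th unit vector of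
  the first summand, this independence holds for every Cartan matrix; and since \<open>y\<close>, the
  second component, is preserved, each choice of \<open>y\<close> gives an affine action on the first summand.

  That the affine maps satisfy the Coxeter relations is checked in \<open>affine_reflection_braid\<close>.
\<close>

section \<open>Actions of Coxeter groups\<close>

text \<open>A formal inverse acts like its generator, since the generators are to act as involutions.\<close>

definition word_act :: "('a \<Rightarrow> 'b \<Rightarrow> 'b) \<Rightarrow> ('a \<times> bool) list \<Rightarrow> 'b \<Rightarrow> 'b" where
  "word_act f u = foldr (\<lambda>l. f (fst l)) u"

lemma word_act_Nil [simp]: "word_act f [] x = x"
  and word_act_Cons [simp]: "word_act f (l # u) x = f (fst l) (word_act f u x)"
  and word_act_append [simp]: "word_act f (u @ v) x = word_act f u (word_act f v x)"
  by (simp_all add: word_act_def)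

lemma word_act_alternating:
  "word_act f (concat (replicate k [(s, True), (t, True)])) x = ((f s \<circ> f t) ^^ k) x"
  by (induction k) simp_all

text \<open>Any representative serves once \<open>f\<close> satisfies the Coxeter relations: see \<open>class_act_cls\<close> below.\<close>

definition class_act :: "('a \<Rightarrow> 'b \<Rightarrow> 'b) \<Rightarrow> ('a \<times> bool) list set \<Rightarrow> 'b \<Rightarrow> 'b" where
  "class_act f A = word_act f (SOME u. u \<in> A)"

locale coxeter_action =
  fixes S :: "'a set" and m :: "'a \<Rightarrow> 'a \<Rightarrow> enat" and f :: "'a \<Rightarrow> 'b \<Rightarrow> 'b"
  assumes involution: "s \<in> S \<Longrightarrow> f s (f s x) = x"
    and braid: "s \<in> S \<Longrightarrow> t \<in> S \<Longrightarrow> s \<noteq> t \<Longrightarrow> m s t = enat k \<Longrightarrow> ((f s \<circ> f t) ^^ k) x = x"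
begin

abbreviation "W \<equiv> coxeter_group S m"
abbreviation "cls u \<equiv> pres_rel S (coxeter_relators S m) `` {u}"

lemma word_act_cong:
  assumes "(u, v) \<in> pres_rel S (coxeter_relators S m)"
  shows "word_act f u x = word_act f v x"
  using assms
proof (induction arbitrary: x rule: pres_rel.induct)
  case (relator u v r)
  have "word_act f r z = z" for z
    using relator(3) involution braid by (auto simp: coxeter_relators_def word_act_alternating)
  then show ?case by simp
qed (simp_all add: involution)

lemma class_act_cls:
  assumes "u \<in> group_words S"
  shows "class_act f (cls u) = word_act f u"
proof -
  have "u \<in> cls u" using assms by (auto intro: pres_rel.refl)
  then have "(SOME v. v \<in> cls u) \<in> cls u" by (rule someI)
  then show ?thesis unfolding class_act_def using word_act_cong by (metis Image_singleton_iff ext)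
qed

lemma class_act_gen: "s \<in> S \<Longrightarrow> class_act f (coxeter_gen S m s) = f s"
  unfolding coxeter_gen_def by (subst class_act_cls) (auto simp: group_words_def)

lemma class_act_one: "class_act f \<one>\<^bsub>W\<^esub> x = x"
proof -
  have "\<one>\<^bsub>W\<^esub> = cls []" by (simp add: coxeter_group_def presented_group_def)
  then show ?thesis by (simp add: class_act_cls group_words_def)
qed

lemma carrier_cls: "carrier W = cls ` group_words S"
  by (auto simp: coxeter_group_def presented_group_def quotient_def)

lemma class_act_mult:
  assumes "g \<in> carrier W" "h \<in> carrier W"
  shows "class_act f (g \<otimes>\<^bsub>W\<^esub> h) x = class_act f g (class_act f h x)"
proof -
  obtain u v where uv: "u \<in> group_words S" "g = cls u" "v \<in> group_words S" "h = cls v"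
    using assms by (auto simp: carrier_cls)
  then have "g \<otimes>\<^bsub>W\<^esub> h = cls (u @ v)"
    by (simp add: coxeter_group_def presented_group_mult)
  moreover have "u @ v \<in> group_words S" using uv by (simp add: group_words_def)
  ultimately show ?thesis using uv by (simp add: class_act_cls)
qed

lemma class_act_fixed:
  assumes "\<And>s. s \<in> S \<Longrightarrow> f s x = x" "g \<in> carrier W"
  shows "class_act f g x = x"
proof -
  obtain u where u: "u \<in> group_words S" "g = cls u" using assms by (auto simp: carrier_cls)
  have "word_act f u x = x"
    using u(1) by (induction u) (auto simp: group_words_def assms(1))
  then show ?thesis using u by (simp add: class_act_cls)
qed

end

section \<open>Generators and Coxeter elements\<close>

lemma group_coxeter_group: "group (coxeter_group S m)"
  by (simp add: coxeter_group_def group_presented_group)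

lemma coxeter_gen_closed: "s \<in> S \<Longrightarrow> coxeter_gen S m s \<in> carrier (coxeter_group S m)"
  by (auto simp: coxeter_gen_def coxeter_group_def presented_group_def quotient_def group_words_def)

lemma coxeter_letter_in_generate:
  assumes "s \<in> S"
  shows "pres_rel S (coxeter_relators S m) `` {[(s, b)]} \<in> generate (coxeter_group S m) (coxeter_gen S m ` S)"
proof (cases b)
  case True
  then show ?thesis using assms by (auto simp: coxeter_gen_def intro: generate.incl)
next
  case False
  let ?G = "coxeter_group S m" and ?c = "\<lambda>u. pres_rel S (coxeter_relators S m) `` {u}"
  have w: "[(s, b)] \<in> group_words S" for b using assms by (simp add: group_words_def)
  have "([(s, False), (s, True)], []) \<in> pres_rel S (coxeter_relators S m)"
    using pres_rel.cancel[of "[]" S "[]" s False] assms by (simp add: group_words_def)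
  then have "?c [(s, False)] \<otimes>\<^bsub>?G\<^esub> coxeter_gen S m s = \<one>\<^bsub>?G\<^esub>"
    unfolding coxeter_gen_def coxeter_group_def presented_group_mult[OF w w]
    by (simp add: presented_group_def equiv_class_eq[OF equiv_pres_rel])
  moreover have "?c [(s, False)] \<in> carrier ?G"
    using w by (auto simp: coxeter_group_def presented_group_def quotient_def)
  ultimately have "?c [(s, False)] = inv\<^bsub>?G\<^esub> coxeter_gen S m s"
    using group.inv_equality[OF group_coxeter_group] coxeter_gen_closed[OF assms] by metis
  then show ?thesis using False assms by (auto intro: generate.inv)
qed

lemma standard_parabolic_all: "standard_parabolic S m S = carrier (coxeter_group S m)"
proof
  let ?G = "coxeter_group S m" and ?c = "\<lambda>u. pres_rel S (coxeter_relators S m) `` {u}"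
  show "standard_parabolic S m S \<subseteq> carrier ?G"
    unfolding standard_parabolic_def
    using group.generate_incl[OF group_coxeter_group] coxeter_gen_closed by (metis image_subsetI)
  have "?c u \<in> generate ?G (coxeter_gen S m ` S)" if "u \<in> group_words S" for u
    using that
  proof (induction u)
    case Nil
    have "?c [] = \<one>\<^bsub>?G\<^esub>" by (simp add: coxeter_group_def presented_group_def)
    then show ?case by (simp add: generate.one)
  next
    case (Cons l u)
    obtain s b where l: "l = (s, b)" by force
    have s: "s \<in> S" and u: "u \<in> group_words S" and w: "[l] \<in> group_words S"
      using Cons.prems by (auto simp: l group_words_def)
    have "?c (l # u) = ?c [l] \<otimes>\<^bsub>?G\<^esub> ?c u"
      using presented_group_mult[OF w u] by (simp add: coxeter_group_def)
    then show ?case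
      using generate.eng[OF coxeter_letter_in_generate[OF s] Cons.IH[OF u]] by (simp add: l)
  qed
  then show "carrier ?G \<subseteq> standard_parabolic S m S"
    by (auto simp: standard_parabolic_def coxeter_group_def presented_group_def quotient_def)
qed

lemma (in group) conjugation_surj:
  assumes "g \<in> carrier G"
  shows "(\<lambda>x. g \<otimes> x \<otimes> inv g) ` carrier G = carrier G"
proof
  show "carrier G \<subseteq> (\<lambda>x. g \<otimes> x \<otimes> inv g) ` carrier G"
  proof
    fix w assume w: "w \<in> carrier G"
    have "w = g \<otimes> (inv g \<otimes> w \<otimes> g) \<otimes> inv g"
      using assms w by (simp add: m_assoc, simp add: m_assoc[symmetric])
    then show "w \<in> (\<lambda>x. g \<otimes> x \<otimes> inv g) ` carrier G" using assms w by blast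
  qed
qed (use assms in auto)

lemma coxeter_product_closed:
  "set xs \<subseteq> S \<Longrightarrow>
    foldr (\<lambda>s w. coxeter_gen S m s \<otimes>\<^bsub>coxeter_group S m\<^esub> w) xs \<one>\<^bsub>coxeter_group S m\<^esub>
      \<in> carrier (coxeter_group S m)"
  using group.is_monoid[OF group_coxeter_group]
  by (induction xs) (auto intro!: monoid.m_closed monoid.one_closed coxeter_gen_closed)

lemma coxeter_element_closed:
  "set ss \<subseteq> S \<Longrightarrow> coxeter_element S m ss \<in> carrier (coxeter_group S m)"
  unfolding coxeter_element_def by (rule coxeter_product_closed) simp

context coxeter_action
begin

lemma class_act_product:
  "set xs \<subseteq> S \<Longrightarrow>
    class_act f (foldr (\<lambda>s w. coxeter_gen S m s \<otimes>\<^bsub>W\<^esub> w) xs \<one>\<^bsub>W\<^esub>) x = foldr f xs x"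
  by (induction xs)
    (simp_all add: class_act_one class_act_mult class_act_gen coxeter_gen_closed coxeter_product_closed)

lemma class_act_coxeter_element:
  "set ss \<subseteq> S \<Longrightarrow> class_act f (coxeter_element S m ss) x = fold f ss x"
  unfolding coxeter_element_def by (subst class_act_product) (simp_all add: foldr_conv_fold)

lemma class_act_inv:
  assumes "g \<in> carrier W"
  shows "class_act f (inv\<^bsub>W\<^esub> g) (class_act f g x) = x"
proof -
  interpret W: group W by (rule group_coxeter_group)
  show ?thesis using class_act_mult[of "inv\<^bsub>W\<^esub> g" g x] assms by (simp add: class_act_one)
qed

lemma class_act_standard_parabolic:
  assumes "X \<subseteq> S" and fixed: "\<And>s. s \<in> X \<Longrightarrow> f s x = x" and "g \<in> standard_parabolic S m X"
  shows "class_act f g x = x"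
  using assms(3) unfolding standard_parabolic_def
proof (induction rule: generate.induct)
  case one
  then show ?case by (rule class_act_one)
next
  case (incl h)
  then show ?case using assms(1) fixed by (auto simp: class_act_gen)
next
  case (inv h)
  then obtain s where s: "s \<in> X" "h = coxeter_gen S m s" by blast
  then have "class_act f h x = x" using assms(1) fixed by (auto simp: class_act_gen)
  then show ?case using class_act_inv[of h x] s assms(1) by (auto simp: coxeter_gen_closed)
next
  case (eng h1 h2)
  have "generate W (coxeter_gen S m ` X) \<subseteq> carrier W"
    using assms(1) by (intro group.generate_incl group_coxeter_group) (auto simp: coxeter_gen_closed)
  then show ?case using eng by (simp add: class_act_mult subset_iff)
qed

end

section \<open>The affine reflections\<close>

text \<open>The value for \<open>m s t = \<infinity>\<close> continues \<open>- 2 cos (\<pi> / k)\<close> to the limit.\<close>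

definition cartan_number :: "('a \<Rightarrow> 'a \<Rightarrow> enat) \<Rightarrow> 'a \<Rightarrow> 'a \<Rightarrow> real" where
  "cartan_number m s t =
     (if s = t then 2 else case m s t of enat k \<Rightarrow> - 2 * cos (pi / k) | \<infinity> \<Rightarrow> - 2)"

definition affine_root ::
    "'a set \<Rightarrow> ('a \<Rightarrow> 'a \<Rightarrow> enat) \<Rightarrow> ('a \<Rightarrow> real) \<Rightarrow> 'a \<Rightarrow> ('a \<Rightarrow> real) \<Rightarrow> real" where
  "affine_root S m y s x = (\<Sum>t\<in>S. cartan_number m s t * x t) + y s"

definition affine_reflection ::
    "'a set \<Rightarrow> ('a \<Rightarrow> 'a \<Rightarrow> enat) \<Rightarrow> ('a \<Rightarrow> real) \<Rightarrow> 'a \<Rightarrow> ('a \<Rightarrow> real) \<Rightarrow> 'a \<Rightarrow> real" where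
  "affine_reflection S m y s x = x(s := x s - affine_root S m y s x)"

lemma affine_root_upd:
  assumes "finite S" "s \<in> S"
  shows "affine_root S m y r (x(s := c)) = affine_root S m y r x + cartan_number m r s * (c - x s)"
proof -
  have "(\<Sum>t\<in>S. cartan_number m r t * (x(s := c)) t) - (\<Sum>t\<in>S. cartan_number m r t * x t)
      = (\<Sum>t\<in>S. if t = s then cartan_number m r s * (c - x s) else 0)"
    unfolding sum_subtractf[symmetric] by (rule sum.cong) (auto simp: algebra_simps)
  then show ?thesis using assms by (simp add: affine_root_def)
qed

lemma affine_root_reflection:
  assumes "finite S" "s \<in> S"
  shows "affine_root S m y r (affine_reflection S m y s x)
    = affine_root S m y r x - cartan_number m r s * affine_root S m y s x"
  using assms by (simp add: affine_reflection_def affine_root_upd)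

lemma affine_reflection_involution:
  assumes "finite S" "s \<in> S"
  shows "affine_reflection S m y s (affine_reflection S m y s x) = x"
proof -
  have "affine_root S m y s (affine_reflection S m y s x) = - affine_root S m y s x"
    using assms by (simp add: affine_root_reflection cartan_number_def)
  then show ?thesis by (simp add: affine_reflection_def)
qed

text \<open>The two reflections act linearly on the pair of values of the roots of \<open>t\<close> and \<open>s\<close>, the
  constants \<open>y\<close> being absorbed in these values. On such pairs their product is, for \<open>k \<ge> 2\<close>,
  conjugate to the rotation through \<open>2\<pi> / k\<close>; the coefficients below, divided by \<open>sin \<theta>\<close>, are the entries of its
  \<open>n\<close>-th power. Working with these values avoids the inhomogeneous terms of the affine maps.\<close>

lemma affine_root_rotation:
  fixes x y :: "'a \<Rightarrow> real" and k n :: nat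
  assumes "finite S" "s \<in> S" "t \<in> S" "s \<noteq> t" "m s t = enat k" "m t s = enat k"
  defines "\<theta> \<equiv> pi / k"
    and "x' \<equiv> \<lambda>n::nat. ((affine_reflection S m y s \<circ> affine_reflection S m y t) ^^ n) x"
  shows "sin \<theta> * affine_root S m y t (x' n) =
      sin ((2 * real n + 1) * \<theta>) * affine_root S m y t x + sin (2 * real n * \<theta>) * affine_root S m y s x"
    and "sin \<theta> * affine_root S m y s (x' n) =
      - sin (2 * real n * \<theta>) * affine_root S m y t x - sin ((2 * real n - 1) * \<theta>) * affine_root S m y s x"
proof (induction n)
  case 0
  {
    case 1
    show ?case by (simp add: x'_def)
  next
    case 2
    show ?case by (simp add: x'_def)
  }
next
  case (Suc n)
  have a: "cartan_number m s t = - 2 * cos \<theta>" "cartan_number m t s = - 2 * cos \<theta>"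
    "cartan_number m s s = 2" "cartan_number m t t = 2"
    using assms(4-6) by (auto simp: cartan_number_def \<theta>_def)
  define p q where "p = affine_root S m y t (x' n)" and "q = affine_root S m y s (x' n)"
  define P Q where "P = affine_root S m y t x" and "Q = affine_root S m y s x"
  have step: "x' (Suc n) = affine_reflection S m y s (affine_reflection S m y t (x' n))"
    by (simp add: x'_def)
  have s': "affine_root S m y s (x' (Suc n)) = - (q + 2 * cos \<theta> * p)"
    and t': "affine_root S m y t (x' (Suc n)) = - p + 2 * cos \<theta> * (q + 2 * cos \<theta> * p)"
    unfolding step using assms(1-3) by (simp_all add: affine_root_reflection a p_def q_def)
  define z where "z j = sin ((2 * real n + j) * \<theta>)" for j
  \<comment> \<open>A reflection replaces one root value by the same three-term recurrence, with coefficient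
    \<open>2 cos \<theta>\<close>, as \<open>z\<close> satisfies; so a step of the product advances the index by two.\<close>
  have rec: "z (j + 1) = 2 * cos \<theta> * z j - z (j - 1)" for j
  proof -
    have "(2 * real n + (j + 1)) * \<theta> = (2 * real n + j) * \<theta> + \<theta>"
      and "(2 * real n + (j - 1)) * \<theta> = (2 * real n + j) * \<theta> - \<theta>"
      by (simp_all add: algebra_simps)
    then show ?thesis by (simp add: z_def sin_add sin_diff)
  qed
  have z1: "z 1 = 2 * cos \<theta> * z 0 - z (- 1)" and z2: "z 2 = 2 * cos \<theta> * z 1 - z 0"
    and z3: "z 3 = 2 * cos \<theta> * z 2 - z 1"
    using rec[of 0] rec[of 1] rec[of 2] by simp_all
  have p: "sin \<theta> * p = z 1 * P + z 0 * Q" and q: "sin \<theta> * q = - z 0 * P - z (- 1) * Q"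
    using Suc by (simp_all add: p_def q_def P_def Q_def z_def)
  have mid: "sin \<theta> * (q + 2 * cos \<theta> * p) = z 2 * P + z 1 * Q"
  proof -
    have "sin \<theta> * (q + 2 * cos \<theta> * p) = sin \<theta> * q + 2 * cos \<theta> * (sin \<theta> * p)"
      by (simp add: algebra_simps)
    also have "\<dots> = z 2 * P + z 1 * Q" unfolding p q z2 z1 by (simp add: algebra_simps)
    finally show ?thesis .
  qed
  have top: "sin \<theta> * (- p + 2 * cos \<theta> * (q + 2 * cos \<theta> * p)) = z 3 * P + z 2 * Q"
  proof -
    have "sin \<theta> * (- p + 2 * cos \<theta> * (q + 2 * cos \<theta> * p))
        = - (sin \<theta> * p) + 2 * cos \<theta> * (sin \<theta> * (q + 2 * cos \<theta> * p))"
      by (simp add: algebra_simps)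
    also have "\<dots> = z 3 * P + z 2 * Q" unfolding p mid z3 z2 by (simp add: algebra_simps)
    finally show ?thesis .
  qed
  have idx: "sin ((2 * real (Suc n) + 1) * \<theta>) = z 3" "sin (2 * real (Suc n) * \<theta>) = z 2"
    "sin ((2 * real (Suc n) - 1) * \<theta>) = z 1"
    by (simp_all add: z_def add.commute)
  {
    case 1
    show ?case using top unfolding t' idx P_def Q_def by simp
  next
    case 2
    show ?case using mid unfolding s' idx P_def Q_def mult_minus_right by linarith
  }
qed

text \<open>After \<open>k\<close> steps the rotation has returned the values of the two roots. Only the coordinates at
  \<open>s\<close> and \<open>t\<close> have moved, and they are determined by these values because the Cartan matrix of a
  finite dihedral group has determinant \<open>4 sin\<^sup>2 (\<pi> / k) \<noteq> 0\<close>.\<close>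

lemma affine_reflection_braid:
  fixes x :: "'a \<Rightarrow> real"
  assumes "finite S" "s \<in> S" "t \<in> S" "s \<noteq> t" "m s t = enat k" "m t s = enat k" "k \<ge> 2"
  shows "((affine_reflection S m y s \<circ> affine_reflection S m y t) ^^ k) x = x"
proof -
  define \<theta> where "\<theta> = pi / k"
  define x' where "x' = ((affine_reflection S m y s \<circ> affine_reflection S m y t) ^^ k) x"
  have \<theta>: "0 < \<theta>" "\<theta> < pi" "real k * \<theta> = pi"
    using assms(7) by (simp_all add: \<theta>_def field_simps)
  have sin: "sin \<theta> > 0" using \<theta> by (simp add: sin_gt_zero)
  have "2 * real k * \<theta> = 2 * pi" using \<theta>(3) by simp
  then have full: "sin (2 * real k * \<theta>) = 0" "cos (2 * real k * \<theta>) = 1"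
    by (simp_all only: sin_two_pi cos_two_pi)
  then have per: "sin ((2 * real k + 1) * \<theta>) = sin \<theta>" "sin ((2 * real k - 1) * \<theta>) = - sin \<theta>"
    by (simp_all add: distrib_right left_diff_distrib sin_add sin_diff)
  have root: "affine_root S m y t x' = affine_root S m y t x"
    "affine_root S m y s x' = affine_root S m y s x"
    using affine_root_rotation[OF assms(1-6), where y = y and n = k and x = x, folded \<theta>_def x'_def] sin
    by (simp_all add: full per)
  have "((affine_reflection S m y s \<circ> affine_reflection S m y t) ^^ n) x r = x r"
    if "r \<noteq> s" "r \<noteq> t" for n r
    using that by (induction n) (auto simp: affine_reflection_def)
  then have upd: "x' = x(s := x' s, t := x' t)" by (auto simp: x'_def)
  define d e where "d = x' s - x s" and "e = x' t - x t"
  have lin: "affine_root S m y r x' = affine_root S m y r x + cartan_number m r s * d + cartan_number m r t * e"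
    for r
    by (subst upd) (use assms in \<open>simp add: affine_root_upd d_def e_def\<close>)
  have "2 * d - 2 * cos \<theta> * e = 0" "2 * e - 2 * cos \<theta> * d = 0"
    using lin[of s] lin[of t] root assms(4-6) by (auto simp: cartan_number_def \<theta>_def)
  then have de: "d = cos \<theta> * e" "e = cos \<theta> * d" by simp_all
  have c: "1 - cos \<theta> * cos \<theta> \<noteq> 0"
    using sin sin_squared_eq[of \<theta>] by (metis less_irrefl power2_eq_square zero_eq_power2)
  have "(1 - cos \<theta> * cos \<theta>) * d = 0" "(1 - cos \<theta> * cos \<theta>) * e = 0"
    using de by (simp_all add: left_diff_distrib mult.assoc)
  then have "d = 0" "e = 0" using c by simp_all
  then have "x' = x" using upd by (simp add: d_def e_def)
  then show ?thesis by (simp add: x'_def)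
qed

lemma coxeter_action_affine_reflection:
  assumes "finite S" "coxeter_matrix S m"
  shows "coxeter_action S m (affine_reflection S m y)"
proof
  fix s t k x assume st: "s \<in> S" "t \<in> S" "s \<noteq> t" "m s t = enat k"
  then have "m t s = enat k" "enat k \<ge> 2" using assms(2) by (metis coxeter_matrix_def)+
  moreover from this have "k \<ge> 2" by (simp add: numeral_eq_enat)
  ultimately show "((affine_reflection S m y s \<circ> affine_reflection S m y t) ^^ k) x = x"
    using affine_reflection_braid assms(1) st by metis
qed (use assms in \<open>simp add: affine_reflection_involution\<close>)

text \<open>No coordinate is touched twice, so a change made by one reflection could not be undone by a
  later one.\<close>

lemma fixed_by_each_reflection:
  assumes "distinct ss" "fold (affine_reflection S m y) ss x = x" "s \<in> set ss"
  shows "affine_reflection S m y s x = x"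
  using assms
proof (induction ss)
  case (Cons r ss)
  let ?x = "affine_reflection S m y r x"
  have "fold (affine_reflection S m y) us z r = z r" if "r \<notin> set us" for us z
    using that by (induction us arbitrary: z) (auto simp: affine_reflection_def)
  from this[of ss ?x] have "?x r = x r" using Cons.prems by simp
  then have "?x = x" by (simp add: affine_reflection_def)
  then show ?case using Cons by auto
qed simp

section \<open>Coxeter elements are essential\<close>

theorem theorem3p1:
  fixes S :: "'a set" and m :: "'a \<Rightarrow> 'a \<Rightarrow> enat" and ss :: "'a list"
  assumes "finite S" and "coxeter_matrix S m"
    and "distinct ss" and "set ss = S"
  shows "essential S m (coxeter_element S m ss)"
proof -
  let ?W = "coxeter_group S m" and ?c = "coxeter_element S m ss"
  interpret W: group ?W by (rule group_coxeter_group)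
  have False
    if H: "parabolic_subgroup S m H" "H \<noteq> carrier ?W" "?c \<in> H" for H
  proof -
    from H(1) obtain X g where X: "X \<subseteq> S" and g: "g \<in> carrier ?W"
      and Heq: "H = (\<lambda>x. g \<otimes>\<^bsub>?W\<^esub> x \<otimes>\<^bsub>?W\<^esub> inv\<^bsub>?W\<^esub> g) ` standard_parabolic S m X"
      unfolding parabolic_subgroup_def by blast
    have "X \<noteq> S"
      using H(2) W.conjugation_surj[OF g] by (auto simp: Heq standard_parabolic_all)
    then obtain s0 where s0: "s0 \<in> S" "s0 \<notin> X" using X by blast
    define y :: "'a \<Rightarrow> real" where "y = (\<lambda>s. if s = s0 then 1 else 0)"
    define o' :: "'a \<Rightarrow> real" where "o' = (\<lambda>_. 0)"
    let ?f = "affine_reflection S m y"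
    interpret coxeter_action S m ?f
      using assms(1,2) by (rule coxeter_action_affine_reflection)
    have origin: "?f s o' = o' \<longleftrightarrow> s \<noteq> s0" for s
      by (auto simp: affine_reflection_def affine_root_def o'_def y_def fun_eq_iff)
    obtain h where h: "h \<in> standard_parabolic S m X" and c: "?c = g \<otimes>\<^bsub>?W\<^esub> h \<otimes>\<^bsub>?W\<^esub> inv\<^bsub>?W\<^esub> g"
      using H(3) Heq by blast
    have hW: "h \<in> carrier ?W"
    proof (rule subsetD[OF _ h])
      have "coxeter_gen S m ` X \<subseteq> carrier ?W" 
        by (intro image_subsetI coxeter_gen_closed subsetD[OF X])
      then show "standard_parabolic S m X \<subseteq> carrier ?W"
        unfolding standard_parabolic_def by (rule W.generate_incl)
    qed
    define z where "z = class_act ?f g o'"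
    have "class_act ?f h o' = o'"
      using class_act_standard_parabolic[OF X _ h] origin s0(2) by metis
    then have "class_act ?f ?c z = z"
      unfolding c z_def using g hW by (simp add: class_act_mult class_act_inv)
    then have "fold ?f ss z = z" using class_act_coxeter_element assms(4) by simp
    then have fixed: "?f s z = z" if "s \<in> S" for s
      using fixed_by_each_reflection assms(3,4) that by metis
    have "o' = class_act ?f (inv\<^bsub>?W\<^esub> g) z" using class_act_inv[OF g] by (simp add: z_def)
    also have "\<dots> = z" using class_act_fixed fixed g by simp
    finally show False using fixed[OF s0(1)] origin by metis
  qed
  then show ?thesis
    unfolding essential_def using coxeter_element_closed assms(4) by blast
qed

end
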